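(* Let $F:\mathbb{R}^n\to\mathbb{R}^n$ admit continuous derivatives for all $x\in\mathbb{R}^n$, and let $\{x^k\}$ be an infinite sequence generated by Algorithm SRM (described in the context). Suppose that: (a) $\sum_{k=0}^\infty\eta_k=\eta<\infty$ and the level set $\{x\in\mathbb{R}^n\mid f(x)\le f(x^0)+\eta\}$ is bounded; (b) at least one of the following holds: (b1) Algorithm SRM stops at Step 1 for some $k\in\mathbb{N}$; (b2) there is an infinite set $K_1\subset\mathbb{N}$ with $\lim_{k\in K_1}\|F(x^k)\|=0$; (b3) there exist $\omega>0$ and an infinite set $K_2\subset\mathbb{N}$ such that $\lim_{k\in K_2}\alpha_k=0$ and $|\langle v^k,J(x^k)^TF(x^k)\rangle|\ge\omega\|v^k\|\,\|J(x^k)^TF(x^k)\|$ for all $k\in K_2$; (c) there exists $c>0$ such that, for all $k\in\mathbb{N}$, whenever $x^{k+1}\ne x^k+\alpha_kd^k$, one has $\|x^{k+1}-x^k\|\le c\|F(x^k)\|$; (d) for all $\varepsilon>0$ there exists $\delta>0$ such that, whenever $\|x^{k+1}-x^k\|\le\delta$, one has $\|F(x^{k+1})-F(x^k)\|\le\varepsilon$; (e) there exists an infinite set $K\subset\mathbb{N}$ such that $\lim_{k\in K}\|F(x^k)\|=0$; (f) $J(x)$ is nonsingular for all $x\in\mathbb{R}^n$ and $\|J(x)^{-1}\|$ is uniformly bounded for all $x\in\mathbb{R}^n$. Then there exists $x_*\in\mathbb{R}^n$ such that $F(x_* )=0$ and $\lim_{k\to\infty}x^k=x_*$.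
   Context: Notation: $\|\cdot\|$ is the Euclidean norm (and the induced matrix norm), $\mathbb{N}=\{0,1,2,\dots\}$, $J(x)$ is the Jacobian matrix of $F$ at $x$, and $f(x)=\frac12\|F(x)\|^2$. For an infinite set $K=\{k_1<k_2<\cdots\}\subset\mathbb{N}$, $\lim_{k\in K}z_k$ means $\lim_{j\to\infty}z_{k_j}$. Algorithm SRM (for $F:\mathbb{R}^n\to\mathbb{R}^n$). Parameters: $\gamma\in(0,1)$, $0<\sigma_{\min}<\sigma_{\max}<\infty$, $0<\tau_{\min}<\tau_{\max}<1$, a positive integer $M$, a sequence $\{\eta_k\}$ with $\eta_k>0$ for all $k\in\mathbb{N}$ and $\lim_{k\to\infty}\eta_k=0$, and $x^0\in\mathbb{R}^n$. Set $k\leftarrow 0$. Step 1. If $F(x^k)=0$, terminate. Step 2. Choose (arbitrarily) $\sigma_k$ with $|\sigma_k|\in[\sigma_{\min},\sigma_{\max}]$ and $v^k\in\mathbb{R}^n$ with $\|v^k\|=\|F(x^k)\|$. Compute $\bar f_k=\max\{f(x^k),\dots,f(x^{\max\{0,k-M+1\}})\}$. Step 2.1. Set $\alpha_+\leftarrow 1$, $\alpha_-\leftarrow 1$. Step 2.2. Set $d\leftarrow-\sigma_kv^k$, $\alpha\leftarrow\alpha_+$. If $f(x^k+\alpha d)\le\bar f_k+\eta_k-\gamma\alpha^2f(x^k)$ (sufficient decrease condition), define $d^k=d$, $\alpha_k=\alpha$ and go to Step 3. Step 2.3. Set $d\leftarrow\sigma_kv^k$, $\alpha\leftarrow\alpha_-$.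 If the sufficient decrease condition holds, define $d^k=d$, $\alpha_k=\alpha$ and go to Step 3. Step 2.4. Choose $\alpha_+^{\mathrm{new}}\in[\tau_{\min}\alpha_+,\tau_{\max}\alpha_+]$ and $\alpha_-^{\mathrm{new}}\in[\tau_{\min}\alpha_-,\tau_{\max}\alpha_-]$, set $\alpha_+\leftarrow\alpha_+^{\mathrm{new}}$, $\alpha_-\leftarrow\alpha_-^{\mathrm{new}}$, and go to Step 2.2. Step 3. Compute any $x^{k+1}$ such that $f(x^{k+1})\le f(x^k+\alpha_kd^k)$, set $k\leftarrow k+1$, and go to Step 1. *)

theory Defs
  imports "HOL-Analysis.Analysis"
begin

text \<open>
  Algorithm SRM for a nonlinear system \<open>F x = 0\<close>. In a run, \<open>x k\<close>, \<open>\<sigma> k\<close>, \<open>v k\<close>, \<open>d k\<close> and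
  \<open>\<alpha> k\<close> are the iterate, the spectral coefficient, the residual vector, the accepted direction and
  the accepted step length of iteration \<open>k\<close>.
\<close>

definition merit :: "(real ^ 'n \<Rightarrow> real ^ 'n) \<Rightarrow> real ^ 'n \<Rightarrow> real" where
  "merit F x = (1/2) * (norm (F x))\<^sup>2"

text \<open>
  The natural-number subtraction truncates, so \<open>Suc k - M\<close> is \<open>max {0, k - M + 1}\<close>.
\<close>

definition merit_max :: "(real ^ 'n \<Rightarrow> real ^ 'n) \<Rightarrow> nat \<Rightarrow> (nat \<Rightarrow> real ^ 'n) \<Rightarrow> nat \<Rightarrow> real" where
  "merit_max F M x k = Max ((\<lambda>j. merit F (x j)) ` {Suc k - M..k})"

definition sufficient_decrease ::
  "(real ^ 'n \<Rightarrow> real ^ 'n) \<Rightarrow> real \<Rightarrow> nat \<Rightarrow> (nat \<Rightarrow> real) \<Rightarrow> (nat \<Rightarrow> real ^ 'n) \<Rightarrow> nat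
    \<Rightarrow> real ^ 'n \<Rightarrow> real \<Rightarrow> bool" where
  "sufficient_decrease F \<gamma> M \<eta> x k d \<alpha> \<longleftrightarrow>
     merit F (x k + \<alpha> *\<^sub>R d) \<le> merit_max F M x k + \<eta> k - \<gamma> * \<alpha>\<^sup>2 * merit F (x k)"

text \<open>
  \<open>backtracking \<tau>min \<tau>max accept s a\<^sub>+ a\<^sub>- d \<alpha>\<close>: the inner loop, entered with trial steps \<open>a\<^sub>+\<close> along
  \<open>- s\<close> and \<open>a\<^sub>-\<close> along \<open>s\<close>, can exit after finitely many passes with direction \<open>d\<close> and step length \<open>\<alpha>\<close>.
  The direction \<open>- s\<close> is tested first; the loop continues only if both tests fail.
\<close>

inductive backtracking ::
  "real \<Rightarrow> real \<Rightarrow> (real ^ 'n \<Rightarrow> real \<Rightarrow> bool) \<Rightarrow> real ^ 'n \<Rightarrow> real \<Rightarrow> real \<Rightarrow> real ^ 'n \<Rightarrow> real \<Rightarrow> bool"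
  for \<tau>min \<tau>max accept s where
  minus_s: "accept (- s) ap \<Longrightarrow> backtracking \<tau>min \<tau>max accept s ap am (- s) ap"
| plus_s: "\<not> accept (- s) ap \<Longrightarrow> accept s am \<Longrightarrow> backtracking \<tau>min \<tau>max accept s ap am s am"
| shrink: "\<not> accept (- s) ap \<Longrightarrow> \<not> accept s am \<Longrightarrow>
    ap' \<in> {\<tau>min * ap..\<tau>max * ap} \<Longrightarrow> am' \<in> {\<tau>min * am..\<tau>max * am} \<Longrightarrow>
    backtracking \<tau>min \<tau>max accept s ap' am' d \<alpha> \<Longrightarrow>
    backtracking \<tau>min \<tau>max accept s ap am d \<alpha>"

text \<open>
  An infinite run: the stopping test \<open>F (x k) = 0\<close> fails at every iteration.
\<close>

definition SRM_run ::
  "(real ^ 'n \<Rightarrow> real ^ 'n) \<Rightarrow> real \<Rightarrow> real \<Rightarrow> real \<Rightarrow> real \<Rightarrow> real \<Rightarrow> nat \<Rightarrow> (nat \<Rightarrow> real)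
    \<Rightarrow> (nat \<Rightarrow> real ^ 'n) \<Rightarrow> (nat \<Rightarrow> real) \<Rightarrow> (nat \<Rightarrow> real ^ 'n) \<Rightarrow> (nat \<Rightarrow> real ^ 'n) \<Rightarrow> (nat \<Rightarrow> real)
    \<Rightarrow> bool" where
  "SRM_run F \<gamma> \<sigma>min \<sigma>max \<tau>min \<tau>max M \<eta> x \<sigma> v d \<alpha> \<longleftrightarrow>
     (\<forall>k. F (x k) \<noteq> 0 \<and>
          \<bar>\<sigma> k\<bar> \<in> {\<sigma>min..\<sigma>max} \<and>
          norm (v k) = norm (F (x k)) \<and>
          backtracking \<tau>min \<tau>max (sufficient_decrease F \<gamma> M \<eta> x k) (\<sigma> k *\<^sub>R v k) 1 1 (d k) (\<alpha> k) \<and>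
          merit F (x (Suc k)) \<le> merit F (x k + \<alpha> k *\<^sub>R d k))"

definition tendsto_along :: "nat set \<Rightarrow> (nat \<Rightarrow> real) \<Rightarrow> real \<Rightarrow> bool" where
  "tendsto_along K z l \<longleftrightarrow> (\<lambda>j. z (enumerate K j)) \<longlonglongrightarrow> l"

end

theory Submission
  imports Defs
begin

text \<open>
  Every step satisfies \<open>\<parallel>x (k+1) - x k\<parallel> \<le> C \<parallel>F (x k)\<parallel>\<close>. The iterates are bounded, so along the given
  index set they accumulate at a zero \<open>z\<close> of \<open>F\<close>, and the step bound carries the convergence over to
  each fixed shift of the subsequence. Hence \<open>M\<close> consecutive residuals are eventually small, and the
  nonmonotone decrease with summable \<open>\<eta>\<close> keeps all later residuals small: \<open>F (x k) \<longlonglongrightarrow> 0\<close>. Since the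
  Jacobian at \<open>z\<close> is nonsingular, \<open>\<parallel>F y\<parallel> \<ge> m \<parallel>y - z\<parallel>\<close> near \<open>z\<close>, and iterates with small residuals
  and small steps can no longer leave a neighbourhood of \<open>z\<close>.
\<close>

text \<open>Strong induction: for \<open>k >= n\<close> the window of \<open>k\<close> starts no
  earlier than that of \<open>n\<close>, so the induction hypothesis covers all of it, and as \<eta>
  is nonnegative the partial sum up to \<open>k\<close> serves the whole window. The next value then
  costs only one more term. It is used from \<open>n = 0\<close> to bound all iterates and from a
  late block of small residuals to obtain convergence.\<close>

lemma nonmonotone_decrease_bound:
  fixes g \<eta> :: "nat \<Rightarrow> real"
  assumes M: "M > 0" and \<eta>: "\<And>k. \<eta> k \<ge> 0"
    and step: "\<And>k. g (Suc k) \<le> Max (g ` {Suc k - M..k}) + \<eta> k"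
    and window: "\<And>j. j \<in> {Suc n - M..n} \<Longrightarrow> g j \<le> b"
    and j: "j \<ge> Suc n - M"
  shows "g j \<le> b + sum \<eta> {n..<j}"
  using j
proof (induction j rule: less_induct)
  case (less j)
  show ?case
  proof (cases "j \<le> n")
    case True
    then show ?thesis using window[of j] less.prems by simp
  next
    case False
    then obtain k where k: "j = Suc k" "n \<le> k" by (cases j) auto
    have "g i \<le> b + sum \<eta> {n..<k}" if "i \<in> {Suc k - M..k}" for i
    proof -
      have "g i \<le> b + sum \<eta> {n..<i}"
        using that k M by (intro less.IH) auto
      also have "sum \<eta> {n..<i} \<le> sum \<eta> {n..<k}"
        using that \<eta> by (intro sum_mono2) auto
      finally show ?thesis by simp
    qed
    then have "Max (g ` {Suc k - M..k}) \<le> b + sum \<eta> {n..<k}"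
      using M by (subst Max_le_iff) auto
    then show ?thesis using step[of k] k by simp
  qed
qed

text \<open>The trial steps are arbitrary in the unit interval, not fixed at 1, so that the
  induction passes through \<open>shrink\<close>, whose factors cannot leave that interval.\<close>

lemma backtracking_exit:
  assumes "backtracking \<tau>min \<tau>max accept s ap am d \<alpha>"
    and "0 \<le> \<tau>min" "\<tau>max \<le> 1" "ap \<in> {0..1}" "am \<in> {0..1}"
  shows "accept d \<alpha> \<and> (d = s \<or> d = - s) \<and> \<alpha> \<in> {0..1}"
  using assms
proof (induction rule: backtracking.induct)
  case (shrink ap am ap' am' d \<alpha>)
  have *: "t' \<in> {0..1}" if "t \<in> {0..1}" "t' \<in> {\<tau>min * t..\<tau>max * t}" for t t'
  proof -
    have "0 \<le> \<tau>min * t" using that shrink.prems by simp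
    moreover have "\<tau>max * t \<le> 1 * t" using that shrink.prems by (intro mult_right_mono) auto
    ultimately show ?thesis using that by auto
  qed
  show ?case using shrink.IH shrink.prems * shrink.hyps(3,4) by blast
qed auto

text \<open>An injective linear map on a finite-dimensional space is bounded below by some
  \<open>B > 0\<close>. Near \<open>z\<close> the linearization error uses up at most half of that
  bound.\<close>

lemma norm_ge_near_nondegenerate_zero:
  fixes F :: "'a::euclidean_space \<Rightarrow> 'b::euclidean_space"
  assumes F: "(F has_derivative F') (at z)" and "inj F'" and "F z = 0"
  obtains m r where "m > 0" "r > 0" "\<And>y. dist y z < r \<Longrightarrow> m * dist y z \<le> norm (F y)"
proof -
  have "linear F'" using F has_derivative_linear by blast
  then obtain B where B: "B > 0" "\<And>h. B * norm h \<le> norm (F' h)"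
    using linear_inj_bounded_below_pos \<open>inj F'\<close> by metis
  obtain r where r: "r > 0"
    "\<And>y. norm (y - z) < r \<Longrightarrow> norm (F y - F z - F' (y - z)) \<le> B/2 * norm (y - z)"
    using F B(1) unfolding has_derivative_at_alt by (meson half_gt_zero)
  have "B/2 * dist y z \<le> norm (F y)" if "dist y z < r" for y
  proof -
    have "norm (F' (y - z)) \<le> norm (F y) + norm (F y - F' (y - z))"
      by (metis norm_triangle_sub norm_minus_commute)
    moreover have "norm (F y - F' (y - z)) \<le> B/2 * norm (y - z)"
      using r(2)[of y] that \<open>F z = 0\<close> by (simp add: dist_norm)
    ultimately show ?thesis using B(2)[of "y - z"] by (simp add: dist_norm)
  qed
  with B r show thesis by (intro that[of "B/2" r]) auto
qed

text \<open>A trapping argument: in the ball where the lower bound is valid, the distance to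
  \<open>z\<close> is controlled by the residual. The subsequence enters this ball late, and from
  then on the small residuals keep the sequence inside.\<close>

lemma tendsto_nondegenerate_zero:
  fixes F :: "'a::euclidean_space \<Rightarrow> 'b::euclidean_space"
  assumes F: "(F has_derivative F') (at z)" "inj F'" "F z = 0"
    and residual: "(\<lambda>k. F (x k)) \<longlonglongrightarrow> 0"
    and increment: "\<And>k. norm (x (Suc k) - x k) \<le> C * norm (F (x k))"
    and sub: "strict_mono r" "(x \<circ> r) \<longlonglongrightarrow> z"
  shows "x \<longlonglongrightarrow> z"
proof -
  obtain m R where m: "m > 0" and R: "R > 0"
    and lower: "\<And>y. dist y z < R \<Longrightarrow> m * dist y z \<le> norm (F y)"
    using norm_ge_near_nondegenerate_zero[OF F] by metis
  have norm0: "(\<lambda>k. norm (F (x k))) \<longlonglongrightarrow> 0"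
    using residual tendsto_norm_zero by blast
  \<comment> \<open>Inside the ball, \<open>1 / m\<close> times the residual bounds the current
    distance to \<open>z\<close>, and \<open>C\<close> times the residual bounds the next step; the
    sum bounds the next distance.\<close>
  have "(\<lambda>k. (1 / m + C) * norm (F (x k))) \<longlonglongrightarrow> 0"
    using tendsto_mult_right_zero[OF norm0] .
  then have "\<forall>\<^sub>F k in sequentially. (1 / m + C) * norm (F (x k)) < R"
    using R order_tendstoD(2) by blast
  then obtain N where N: "\<And>k. k \<ge> N \<Longrightarrow> (1 / m + C) * norm (F (x k)) < R"
    unfolding eventually_sequentially by blast
  have "\<forall>\<^sub>F j in sequentially. dist (x (r j)) z < R"
    using tendstoD[OF sub(2) R] by simp
  then obtain j where "j \<ge> N" "dist (x (r j)) z < R"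
    unfolding eventually_sequentially by (meson nle_le)
  then obtain k0 where k0: "k0 \<ge> N" "dist (x k0) z < R"
    using seq_suble[OF sub(1), of j] le_trans by blast
  have near: "dist (x k) z < R" if "k \<ge> k0" for k
    using that
  proof (induction k rule: dec_induct)
    case (step k)
    have "dist (x (Suc k)) z \<le> norm (x (Suc k) - x k) + dist (x k) z"
      by (metis dist_norm dist_triangle)
    also have "\<dots> \<le> C * norm (F (x k)) + norm (F (x k)) / m"
      using increment[of k] lower[OF step.IH] m by (intro add_mono) (auto simp: field_simps)
    also have "\<dots> = (1 / m + C) * norm (F (x k))"
      by (simp add: algebra_simps)
    also have "\<dots> < R" using N k0(1) step.hyps by simp
    finally show ?case .
  qed (use k0 in simp)
  have "\<forall>\<^sub>F k in sequentially. dist (x k) z \<le> norm (F (x k)) / m"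
    using near lower m unfolding eventually_sequentially
    by (intro exI[of _ k0]) (auto simp: field_simps)
  moreover have "(\<lambda>k. norm (F (x k)) / m) \<longlonglongrightarrow> 0"
    using tendsto_divide_zero[OF norm0] .
  ultimately have "(\<lambda>k. dist (x k) z) \<longlonglongrightarrow> 0"
    by (rule tendsto_sandwich[OF always_eventually[OF allI, OF zero_le_dist] _ tendsto_const])
  then show ?thesis using tendsto_dist_iff by blast
qed

text \<open>By continuity the residuals at shift \<open>i\<close> tend to \<open>F z = 0\<close>, so
  the steps from there vanish and shift \<open>i + 1\<close> has the same limit.\<close>

lemma shifted_subsequence_tendsto:
  fixes F :: "'a::real_normed_vector \<Rightarrow> 'b::real_normed_vector"
  assumes F: "isCont F z" "F z = 0"
    and step: "\<And>k. norm (x (Suc k) - x k) \<le> C * norm (F (x k))"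
    and sub: "(\<lambda>j. x (r j)) \<longlonglongrightarrow> z"
  shows "(\<lambda>j. x (r j + i)) \<longlonglongrightarrow> z"
proof (induction i)
  case (Suc i)
  have "(\<lambda>j. C * norm (F (x (r j + i)))) \<longlonglongrightarrow> 0"
    using isCont_tendsto_compose[OF F(1) Suc] F(2)
    by (intro tendsto_mult_right_zero tendsto_norm_zero) simp
  then have "(\<lambda>j. x (Suc (r j + i)) - x (r j + i)) \<longlonglongrightarrow> 0"
    by (rule Lim_null_comparison[OF always_eventually, rotated]) (use step in blast)
  from tendsto_add[OF this Suc] show ?case by simp
qed (use sub in simp)

lemma nonmonotone_residual_tendsto_0:
  fixes F :: "real ^ 'n \<Rightarrow> real ^ 'n"
  assumes F: "isCont F z" "F z = 0" and M: "M > 0"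
    and \<eta>: "\<And>k. \<eta> k \<ge> 0" "summable \<eta>"
    and decrease: "\<And>k. merit F (x (Suc k)) \<le> merit_max F M x k + \<eta> k"
    and step: "\<And>k. norm (x (Suc k) - x k) \<le> C * norm (F (x k))"
    and sub: "strict_mono r" "(\<lambda>j. x (r j)) \<longlonglongrightarrow> z"
  shows "(\<lambda>k. F (x k)) \<longlonglongrightarrow> 0"
proof -
  have "(\<lambda>k. merit F (x k)) \<longlonglongrightarrow> 0"
  proof (rule LIMSEQ_I)
    fix \<epsilon> :: real assume \<epsilon>: "0 < \<epsilon>"
    have "\<forall>\<^sub>F j in sequentially. merit F (x (r j + i)) < \<epsilon>/2" for i
    proof -
      have "(\<lambda>j. F (x (r j + i))) \<longlonglongrightarrow> 0"
        using isCont_tendsto_compose[OF F(1) shifted_subsequence_tendsto[OF F step sub(2)]] F(2)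
        by simp
      then have "(\<lambda>j. merit F (x (r j + i))) \<longlonglongrightarrow> (1/2) * (norm (0 :: real ^ 'n))\<^sup>2"
        unfolding merit_def by (intro tendsto_intros)
      then show ?thesis using \<epsilon> by (intro order_tendstoD(2)) auto
    qed
    \<comment> \<open>Only \<open>M\<close> shifts matter, so one threshold serves them all.\<close>
    then have "\<forall>\<^sub>F j in sequentially. \<forall>i\<in>{..<M}. merit F (x (r j + i)) < \<epsilon>/2"
      by (intro eventually_ball_finite) auto
    then obtain N1 where N1: "\<And>j i. j \<ge> N1 \<Longrightarrow> i < M \<Longrightarrow> merit F (x (r j + i)) < \<epsilon>/2"
      unfolding eventually_sequentially by blast
    obtain N2 where N2: "\<And>n k. n \<ge> N2 \<Longrightarrow> norm (sum \<eta> {n..<k}) < \<epsilon>/2"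
      using \<eta>(2) \<epsilon> unfolding summable_Cauchy by (meson half_gt_zero)
    define j where "j = max N1 N2"
    \<comment> \<open>The window of \<open>n\<close> is exactly the block of \<open>M\<close>
      indices from \<open>r j\<close> on, since \<open>Suc n - M = r j\<close>. The values there
      take one half of \<epsilon>, the tail of the series the other.\<close>
    define n where "n = r j + M - 1"
    have "j \<le> r j" using seq_suble[OF sub(1)] .
    then have "n \<ge> N2" using M unfolding n_def j_def by linarith
    have "merit F (x k) < \<epsilon>" if "k \<ge> n" for k
    proof -
      have "merit F (x k) \<le> \<epsilon>/2 + sum \<eta> {n..<k}"
      proof (rule nonmonotone_decrease_bound[OF M \<eta>(1)])
        show "merit F (x (Suc k)) \<le> Max ((\<lambda>j. merit F (x j)) ` {Suc k - M..k}) + \<eta> k" for k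
          using decrease[of k] unfolding merit_max_def .
        show "merit F (x i) \<le> \<epsilon>/2" if "i \<in> {Suc n - M..n}" for i
        proof -
          have "i - r j < M" "r j + (i - r j) = i"
            using that M unfolding n_def by auto
          then show ?thesis using N1[of j "i - r j"] unfolding j_def by simp
        qed
        show "Suc n - M \<le> k" using M \<open>k \<ge> n\<close> by linarith
      qed
      then show ?thesis using N2[OF \<open>n \<ge> N2\<close>, of k] by simp
    qed
    then show "\<exists>N. \<forall>k\<ge>N. norm (merit F (x k) - 0) < \<epsilon>"
      by (intro exI[of _ n]) (auto simp: merit_def)
  qed
  then have "(\<lambda>k. sqrt (2 * merit F (x k))) \<longlonglongrightarrow> sqrt (2 * 0)"
    by (intro tendsto_intros)
  then show ?thesis
    by (simp add: merit_def tendsto_norm_zero_iff)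
qed

theorem theorem3p2:
  fixes F :: "real ^ 'n \<Rightarrow> real ^ 'n"
    and \<gamma> \<sigma>min \<sigma>max \<tau>min \<tau>max :: real
    and M :: nat
    and \<eta> \<sigma> \<alpha> :: "nat \<Rightarrow> real"
    and x v d :: "nat \<Rightarrow> real ^ 'n"
  assumes F_differentiable: "\<forall>z. F differentiable (at z)"
    and F_C1: "continuous_on UNIV (\<lambda>z. jacobian F (at z))"
    and \<gamma>: "0 < \<gamma>" "\<gamma> < 1"
    and \<sigma>_bounds: "0 < \<sigma>min" "\<sigma>min < \<sigma>max"
    and \<tau>_bounds: "0 < \<tau>min" "\<tau>min < \<tau>max" "\<tau>max < 1"
    and M: "M > 0"
    and \<eta>: "\<forall>k. \<eta> k > 0" "\<eta> \<longlonglongrightarrow> 0"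
    and run: "SRM_run F \<gamma> \<sigma>min \<sigma>max \<tau>min \<tau>max M \<eta> x \<sigma> v d \<alpha>"
    and a: "summable \<eta>" "bounded {z. merit F z \<le> merit F (x 0) + (\<Sum>k. \<eta> k)}"
    and b: "(\<exists>k. F (x k) = 0) \<or>
      (\<exists>K1. infinite K1 \<and> tendsto_along K1 (\<lambda>k. norm (F (x k))) 0) \<or>
      (\<exists>\<omega>>0. \<exists>K2. infinite K2 \<and> tendsto_along K2 \<alpha> 0 \<and>
         (\<forall>k\<in>K2. \<bar>v k \<bullet> (transpose (jacobian F (at (x k))) *v F (x k))\<bar>
            \<ge> \<omega> * norm (v k) * norm (transpose (jacobian F (at (x k))) *v F (x k))))"
    and c: "\<exists>c>0. \<forall>k. x (Suc k) \<noteq> x k + \<alpha> k *\<^sub>R d k \<longrightarrow>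
      norm (x (Suc k) - x k) \<le> c * norm (F (x k))"
    and d: "\<forall>\<epsilon>>0. \<exists>\<delta>>0. \<forall>k. norm (x (Suc k) - x k) \<le> \<delta> \<longrightarrow>
      norm (F (x (Suc k)) - F (x k)) \<le> \<epsilon>"
    and e: "\<exists>K. infinite K \<and> tendsto_along K (\<lambda>k. norm (F (x k))) 0"
    and f: "\<forall>z. invertible (jacobian F (at z))"
      "\<exists>B. \<forall>z. onorm ((*v) (matrix_inv (jacobian F (at z)))) \<le> B"
  shows "\<exists>x_star. F x_star = 0 \<and> x \<longlonglongrightarrow> x_star"
proof -
  have exit: "sufficient_decrease F \<gamma> M \<eta> x k (d k) (\<alpha> k)"
    "d k = \<sigma> k *\<^sub>R v k \<or> d k = - (\<sigma> k *\<^sub>R v k)" "0 \<le> \<alpha> k" "\<alpha> k \<le> 1"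
    and \<sigma>: "\<bar>\<sigma> k\<bar> \<le> \<sigma>max" and v: "norm (v k) = norm (F (x k))"
    and accepted: "merit F (x (Suc k)) \<le> merit F (x k + \<alpha> k *\<^sub>R d k)" for k
    using run backtracking_exit[of \<tau>min \<tau>max _ _ 1 1 "d k" "\<alpha> k"] \<tau>_bounds
    unfolding SRM_run_def by auto
  have decrease: "merit F (x (Suc k)) \<le> merit_max F M x k + \<eta> k" for k
  proof -
    have "0 \<le> \<gamma> * (\<alpha> k)\<^sup>2 * merit F (x k)" using \<gamma> by (simp add: merit_def)
    then show ?thesis
      using exit(1)[of k] accepted[of k] unfolding sufficient_decrease_def by linarith
  qed
  obtain c where c: "\<And>k. x (Suc k) \<noteq> x k + \<alpha> k *\<^sub>R d k \<Longrightarrow>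
      norm (x (Suc k) - x k) \<le> c * norm (F (x k))"
    using c by blast
  \<comment> \<open>If the accepted trial point is kept, the step length is at most 1 and the
    direction is at most \<sigma>max times the residual; any other choice falls under the assumption
    with \<open>c\<close>.\<close>
  have step: "norm (x (Suc k) - x k) \<le> max c \<sigma>max * norm (F (x k))" for k
  proof (cases "x (Suc k) = x k + \<alpha> k *\<^sub>R d k")
    case True
    have "norm (x (Suc k) - x k) = \<alpha> k * (\<bar>\<sigma> k\<bar> * norm (F (x k)))"
      using True exit(2,3)[of k] v[of k] by auto
    also have "\<dots> \<le> 1 * (max c \<sigma>max * norm (F (x k)))"
      using exit(3,4)[of k] \<sigma>[of k] by (intro mult_mono) auto
    finally show ?thesis by simp
  next
    case False
    then have "norm (x (Suc k) - x k) \<le> c * norm (F (x k))" by (rule c)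
    also have "\<dots> \<le> max c \<sigma>max * norm (F (x k))" by (intro mult_right_mono) auto
    finally show ?thesis .
  qed
  have \<eta>_nonneg: "\<eta> k \<ge> 0" for k using \<eta>(1) less_imp_le by blast
  have "merit F (x k) \<le> merit F (x 0) + (\<Sum>k. \<eta> k)" for k
  proof -
    \<comment> \<open>Here \<open>n = 0\<close>: by truncated subtraction its window contains only
      the index 0.\<close>
    have "merit F (x k) \<le> merit F (x 0) + sum \<eta> {0..<k}"
      by (rule nonmonotone_decrease_bound[OF M \<eta>_nonneg])
        (use M decrease in \<open>auto simp: merit_max_def\<close>)
    also have "sum \<eta> {0..<k} \<le> (\<Sum>k. \<eta> k)"
      using a(1) \<eta>_nonneg by (intro sum_le_suminf) auto
    finally show ?thesis by simp
  qed
  then have "bounded (range x)"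
    using bounded_subset[OF a(2)] by blast
  obtain K where K: "infinite K" "(\<lambda>j. norm (F (x (enumerate K j)))) \<longlonglongrightarrow> 0"
    using e unfolding tendsto_along_def by blast
  have "bounded (range (x \<circ> enumerate K))"
    using bounded_subset[OF \<open>bounded (range x)\<close>, of "range (x \<circ> enumerate K)"] by auto
  then obtain z r where r: "strict_mono r" and z: "((x \<circ> enumerate K) \<circ> r) \<longlonglongrightarrow> z"
    using bounded_imp_convergent_subsequence by blast
  \<comment> \<open>Passing from \<open>K\<close> to a further subsequence keeps the residuals
    tending to 0 and makes the iterates converge as well.\<close>
  define s where "s = enumerate K \<circ> r"
  have s: "strict_mono s"
    unfolding s_def using strict_mono_enumerate[OF K(1)] r by (rule strict_mono_o)
  have xs: "(\<lambda>j. x (s j)) \<longlonglongrightarrow> z" using z by (simp add: s_def o_def)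
  have cont: "isCont F z" using F_differentiable differentiable_imp_continuous_within by blast
  have "(\<lambda>j. F (x (s j))) \<longlonglongrightarrow> 0"
    using LIMSEQ_subseq_LIMSEQ[OF K(2) r] by (simp add: s_def o_def tendsto_norm_zero_iff)
  \<comment> \<open>Along \<open>s\<close> the residuals tend to 0 and, by continuity, to
    \<open>F z\<close>.\<close>
  then have Fz: "F z = 0"
    using isCont_tendsto_compose[OF cont xs] LIMSEQ_unique by blast
  have "(\<lambda>k. F (x k)) \<longlonglongrightarrow> 0"
    by (rule nonmonotone_residual_tendsto_0[OF cont Fz M \<eta>_nonneg a(1) decrease step s xs])
  moreover have "(F has_derivative (*v) (jacobian F (at z))) (at z)"
    using F_differentiable jacobian_works by blast
  moreover have "inj ((*v) (jacobian F (at z)))"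
    using f(1) inj_matrix_vector_mult by blast
  ultimately have "x \<longlonglongrightarrow> z"
    using tendsto_nondegenerate_zero[where F = F and x = x and r = s, OF _ _ Fz _ step s] xs
    by (simp add: o_def)
  with Fz show ?thesis by blast
qed

end
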